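(* Let $p$ be an odd prime, and let $H_p$ be the nonabelian group of order $p^3$ and exponent $p$. Then the endomorphism graph of $H_p$ is isomorphic to the endomorphism graph of $\mathbb{Z}_p^3$, but the endomorphism digraph of $H_p$ is not isomorphic to the endomorphism digraph of $\mathbb{Z}_p^3$.
   Context: The endomorphism digraph of a group $G$ has vertex set $G$, with an arc from $x$ to $y$ if $x\neq y$ and some endomorphism of $G$ maps $x$ to $y$. The endomorphism graph of $G$ is the simple undirected graph on $G$ obtained by ignoring directions and suppressing double edges. $\mathbb{Z}_p^3=\mathbb{Z}_p\times\mathbb{Z}_p\times\mathbb{Z}_p$. *)

theory Defs
  imports "HOL-Algebra.Elementary_Groups" "HOL-Computational_Algebra.Primes" "Graph_Theory.Graph_Theory"
begin

definition has_exponent :: "('a, 'm) monoid_scheme \<Rightarrow> nat \<Rightarrow> bool" where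
  "has_exponent G n \<longleftrightarrow>
     0 < n \<and> (\<forall>x\<in>carrier G. x [^]\<^bsub>G\<^esub> n = \<one>\<^bsub>G\<^esub>) \<and>
     (\<forall>m. 0 < m \<and> (\<forall>x\<in>carrier G. x [^]\<^bsub>G\<^esub> m = \<one>\<^bsub>G\<^esub>) \<longrightarrow> n \<le> m)"

definition Z_mod_cube :: "nat \<Rightarrow> (int \<times> int \<times> int) monoid" where
  "Z_mod_cube n = integer_mod_group n \<times>\<times> integer_mod_group n \<times>\<times> integer_mod_group n"

definition endomorphism_digraph :: "('a, 'm) monoid_scheme \<Rightarrow> 'a pair_pre_digraph" where
  "endomorphism_digraph G =
     \<lparr> pverts = carrier G,
       parcs = {(x, y). x \<in> carrier G \<and> y \<in> carrier G \<and> x \<noteq> y \<and> (\<exists>f\<in>hom G G. f x = y)} \<rparr>"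

text \<open>As usual in \<open>Graph_Theory\<close>, a simple undirected graph is a symmetric loop-free digraph;
  \<open>mk_symmetric\<close> adds the reverse of every arc, and arcs being pairs there are no parallel arcs.\<close>

definition endomorphism_graph :: "('a, 'm) monoid_scheme \<Rightarrow> 'a pair_pre_digraph" where
  "endomorphism_graph G = mk_symmetric (with_proj (endomorphism_digraph G))"

text \<open>\<open>digraph_iso\<close> demands that its first argument be well-formed, so the following two facts
  ensure that its negation is not satisfied for lack of well-formedness.\<close>

lemma wf_endomorphism_digraph: "wf_digraph (with_proj (endomorphism_digraph G))"
  by unfold_locales (auto simp: endomorphism_digraph_def)

lemma wf_endomorphism_graph: "wf_digraph (with_proj (endomorphism_graph G))"
  by unfold_locales (auto simp: endomorphism_graph_def endomorphism_digraph_def mk_symmetric_def)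

lemma endomorphism_graph_arc_iff:
  "(x, y) \<in> parcs (endomorphism_graph G) \<longleftrightarrow>
     (x, y) \<in> parcs (endomorphism_digraph G) \<or> (y, x) \<in> parcs (endomorphism_digraph G)"
  unfolding endomorphism_graph_def parcs_mk_symmetric with_proj_simps UN_iff
  by (metis fst_conv snd_conv insert_iff singletonD prod.collapse)

text \<open>Nonabelian groups of order \<open>p\<^sup>3\<close> and exponent \<open>p\<close> exist for every odd prime \<open>p\<close>:
  the Heisenberg group modulo \<open>p\<close> is one.\<close>

definition heisenberg :: "nat \<Rightarrow> (int \<times> int \<times> int) monoid" where
  "heisenberg p =
     \<lparr> carrier = {0..<int p} \<times> {0..<int p} \<times> {0..<int p},
       monoid.mult = (\<lambda>(a, b, c) (a', b', c').
         ((a + a') mod int p, (b + b') mod int p, (c + c' + a * b') mod int p)),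
       one = (0, 0, 0) \<rparr>"

lemma group_heisenberg:
  assumes "p > 0"
  shows "group (heisenberg p)"
proof (rule groupI)
  fix x y z
  assume "x \<in> carrier (heisenberg p)" "y \<in> carrier (heisenberg p)" "z \<in> carrier (heisenberg p)"
  show "x \<otimes>\<^bsub>heisenberg p\<^esub> y \<otimes>\<^bsub>heisenberg p\<^esub> z = x \<otimes>\<^bsub>heisenberg p\<^esub> (y \<otimes>\<^bsub>heisenberg p\<^esub> z)"
  proof -
    obtain a b c a' b' c' a'' b'' c''
      where xyz: "x = (a, b, c)" "y = (a', b', c')" "z = (a'', b'', c'')"
      using prod_cases3 by metis
    have "((c + c' + a * b') mod int p + c'' + (a + a') mod int p * b'') mod int p =
          ((c + c' + a * b') + c'' + (a + a') * b'') mod int p"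
      by (intro mod_add_cong mod_mult_cong refl mod_mod_trivial mod_mod_trivial[symmetric])
    also have "\<dots> = (c + (c' + c'' + a' * b'') + a * (b' + b'')) mod int p"
      by (simp add: algebra_simps)
    also have "\<dots> = (c + (c' + c'' + a' * b'') mod int p + a * ((b' + b'') mod int p)) mod int p"
      by (intro mod_add_cong mod_mult_cong refl mod_mod_trivial mod_mod_trivial[symmetric])
    finally show ?thesis
      by (simp add: xyz heisenberg_def mod_simps add.assoc)
  qed
next
  fix x
  assume x: "x \<in> carrier (heisenberg p)"
  obtain a b c where abc: "x = (a, b, c)" by (cases x)
  have "((a * b - c) mod int p + c + (- a) mod int p * b) mod int p =
        ((a * b - c) + c + (- a) * b) mod int p"
    by (intro mod_add_cong mod_mult_cong refl mod_mod_trivial mod_mod_trivial[symmetric])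
  then have inv: "((a * b - c) mod int p + c + (- a) mod int p * b) mod int p = 0"
    by simp
  show "\<exists>y\<in>carrier (heisenberg p). y \<otimes>\<^bsub>heisenberg p\<^esub> x = \<one>\<^bsub>heisenberg p\<^esub>"
    by (rule bexI[where x = "((- a) mod int p, (- b) mod int p, (a * b - c) mod int p)"])
       (use assms abc inv in \<open>auto simp: heisenberg_def mod_simps\<close>)
qed (use assms in \<open>auto simp: heisenberg_def\<close>)

lemma heisenberg_pow:
  assumes "p > 0"
  shows "(a, b, c) [^]\<^bsub>heisenberg p\<^esub> n =
    ((int n * a) mod int p, (int n * b) mod int p, (int n * c + int (n choose 2) * a * b) mod int p)"
proof (induction n)
  case 0
  show ?case by (simp add: heisenberg_def nat_pow_def binomial_eq_0)
next
  case (Suc n)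
  define k where "k = n choose 2"
  have *: "Suc n choose 2 = n + k"
    by (simp add: k_def numeral_2_eq_2)
  have "((int n * c + int k * a * b) mod int p + c + (int n * a) mod int p * b) mod int p =
        ((int n * c + int k * a * b) + c + (int n * a) * b) mod int p"
    by (intro mod_add_cong mod_mult_cong refl mod_mod_trivial mod_mod_trivial[symmetric])
  also have "\<dots> = (int (Suc n) * c + int (n + k) * a * b) mod int p"
    by (simp add: algebra_simps)
  finally have c: "((int n * c + int k * a * b) mod int p + c + (int n * a) mod int p * b) mod int p =
      (int (Suc n) * c + int (n + k) * a * b) mod int p" .
  have "(a, b, c) [^]\<^bsub>heisenberg p\<^esub> Suc n =
      ((int n * a) mod int p, (int n * b) mod int p, (int n * c + int k * a * b) mod int p)
        \<otimes>\<^bsub>heisenberg p\<^esub> (a, b, c)"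
    by (simp only: k_def Suc[symmetric]) (simp add: nat_pow_def)
  also have "\<dots> = ((int n * a + a) mod int p, (int n * b + b) mod int p,
      (int (Suc n) * c + int (n + k) * a * b) mod int p)"
    unfolding c[symmetric] by (simp add: heisenberg_def mod_simps)
  finally show ?case
    unfolding * by (simp add: algebra_simps)
qed

lemma heisenberg_order_exponent:
  assumes "prime p" and "odd p"
  shows "group (heisenberg p)" and "\<not> comm_group (heisenberg p)"
    and "order (heisenberg p) = p ^ 3" and "has_exponent (heisenberg p) p"
proof -
  have p: "p > 2" using assms prime_ge_2_nat[of p] by (cases "p = 2") auto
  show "group (heisenberg p)" using p by (intro group_heisenberg) simp
  show "\<not> comm_group (heisenberg p)"
  proof
    assume "comm_group (heisenberg p)"
    then interpret comm_group "heisenberg p" .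
    have "(1, 0, 0) \<otimes>\<^bsub>heisenberg p\<^esub> (0, 1, 0) = (0, 1, 0) \<otimes>\<^bsub>heisenberg p\<^esub> (1, 0, 0)"
      by (rule m_comm) (use p in \<open>auto simp: heisenberg_def\<close>)
    then show False using p by (simp add: heisenberg_def)
  qed
  show "order (heisenberg p) = p ^ 3"
    by (simp add: order_def heisenberg_def card_cartesian_product power3_eq_cube)
  obtain k where "p = 2 * k + 1" using \<open>odd p\<close> by (rule oddE)
  then have "p dvd p choose 2" by (auto simp: choose_two intro!: dvdI[of _ _ k])
  then have "int p dvd int (p choose 2)" by simp
  then have "x [^]\<^bsub>heisenberg p\<^esub> p = \<one>\<^bsub>heisenberg p\<^esub>" for x
    using p by (cases x) (simp add: heisenberg_pow, simp add: heisenberg_def mod_eq_0_iff_dvd)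
  moreover have "p \<le> m" if "0 < m" and
    "\<forall>x\<in>carrier (heisenberg p). x [^]\<^bsub>heisenberg p\<^esub> m = \<one>\<^bsub>heisenberg p\<^esub>" for m
  proof -
    have "(1, 0, 0) [^]\<^bsub>heisenberg p\<^esub> m = \<one>\<^bsub>heisenberg p\<^esub>"
      using that(2) p by (force simp: heisenberg_def)
    then have "int m mod int p = 0" using p by (simp add: heisenberg_pow) (simp add: heisenberg_def)
    then have "int p dvd int m" by presburger
    then show ?thesis using \<open>0 < m\<close> by (simp add: dvd_imp_le)
  qed
  ultimately show "has_exponent (heisenberg p) p"
    using p by (auto simp: has_exponent_def)
qed

end

theory Submission
  imports Defs "HOL-Algebra.Group_Action" "HOL-Algebra.Multiplicative_Group" "HOL-Number_Theory.Cong"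
begin

text \<open>
  Both endomorphism graphs are complete, on \<open>p\<^sup>3\<close> vertices each, so they are isomorphic. The
  digraphs are told apart by the number of vertices that fail to have an arc to every other vertex.

  The common source of endomorphisms is \<open>hom_through_character\<close>: if a homomorphism to
  \<open>\<int>\<^sub>p\<close> does not vanish at \<open>x\<close>, then, followed by a homomorphism from \<open>\<int>\<^sub>p\<close> to the cyclic group
  of any \<open>y\<close> with \<open>y\<^sup>p = 1\<close>, it takes \<open>x\<close> to \<open>y\<close>. In \<open>\<int>\<^sub>p\<^sup>3\<close> the coordinates are such characters, so every
  nonzero element has arcs to all other elements, and zero is the only vertex that lacks some.

  A nonabelian group of order \<open>p\<^sup>3\<close> and exponent \<open>p\<close> is the Heisenberg group
  (\<open>heisenberg_iso_if_nonabelian_of_order_prime_cube\<close>): its quotient by the centre is abelian, as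
  its order divides \<open>p\<^sup>2\<close>, so any two noncommuting elements \<open>a\<close>, \<open>b\<close> have a central
  commutator, and \<open>(i, j, k) \<mapsto> b\<^sup>j a\<^sup>i c\<^sup>k\<close> is an isomorphism. In the Heisenberg group the first
  two coordinates are characters and the centre consists of the triples \<open>(0, 0, c)\<close>. Hence a
  noncentral element has arcs to all other elements; a central element other than \<open>1\<close> can be
  mapped to any central element, because \<open>(a, b, c) \<mapsto> (a, k b, k c)\<close> is an endomorphism; and \<open>1\<close> is
  reached from everywhere. So any two vertices are adjacent. But each \<open>(0, 0, c)\<close> is a commutator,
  and so are its images, which are therefore central (\<open>heisenberg_hom_central\<close>). Thus \<open>(0, 0, 0)\<close>
  and \<open>(0, 0, 1)\<close> both lack an arc to \<open>(1, 0, 0)\<close>, whereas \<open>\<int>\<^sub>p\<^sup>3\<close> has only one vertex lacking an arc.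
\<close>

section \<open>Centres of finite p-groups\<close>

definition centre :: "('a, 'm) monoid_scheme \<Rightarrow> 'a set" where
  "centre G = {z \<in> carrier G. \<forall>x\<in>carrier G. z \<otimes>\<^bsub>G\<^esub> x = x \<otimes>\<^bsub>G\<^esub> z}"

text \<open>By the orbit-stabilizer theorem the size of an orbit is a power of \<open>p\<close>; an orbit of size one is a
  fixed point, and the points of a larger orbit, whose size \<open>p\<close> divides, are all moved.\<close>

lemma (in group_action) prime_dvd_card_non_fixed:
  assumes "Factorial_Ring.prime p" and "order G = p ^ n" and "finite E"
  shows "p dvd card {x \<in> E. \<exists>g\<in>carrier G. \<phi> g x \<noteq> x}"
proof -
  let ?N = "{x \<in> E. \<exists>g\<in>carrier G. \<phi> g x \<noteq> x}"
  have "p dvd (\<Sum>x\<in>orb. of_bool (x \<in> ?N))" if orb: "orb \<in> orbits G E \<phi>" for orb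
  proof -
    obtain x where x: "x \<in> E" "orb = orbit G \<phi> x"
      using orb by (auto simp: orbits_def)
    have "card orb dvd p ^ n"
      using orbit_stabilizer_theorem[OF x(1)] x(2) assms(2) by (metis dvd_triv_left)
    then obtain k where k: "card orb = p ^ k"
      using assms(1) divides_primepow_nat by blast
    have orbE: "orb \<subseteq> E"
      using orb orbits_coverture by auto
    show ?thesis
    proof (cases k)
      case 0
      then have "card orb = 1" using k by simp
      then obtain y where y: "orb = {y}" using card_1_singletonE by blast
      have "y = x" using orbit_refl[OF x(1)] y x(2) by auto
      have "\<phi> g x = x" if "g \<in> carrier G" for g
        using that y x(2) \<open>y = x\<close> by (auto simp: orbit_def)
      then show ?thesis using y \<open>y = x\<close> by simp
    next
      case (Suc l)
      have "y \<in> ?N" if y: "y \<in> orb" for y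
      proof (rule ccontr)
        assume "y \<notin> ?N"
        then have "orbit G \<phi> y \<subseteq> {y}" using y orbE by (auto simp: orbit_def)
        moreover have "x \<in> orbit G \<phi> y"
          using orbit_sym[OF x(1), of y] x(2) y orbE by blast
        ultimately have "orb \<subseteq> {y}" using x(2) by blast
        then have "card orb \<le> 1" using card_mono[of "{y}" orb] by simp
        then show False using k Suc one_less_power[OF prime_gt_1_nat[OF assms(1)], of k] by simp
      qed
      then have "(\<Sum>x\<in>orb. of_bool (x \<in> ?N)) = card orb" by simp
      then show ?thesis using k Suc by simp
    qed
  qed
  then have "p dvd (\<Sum>orb\<in>orbits G E \<phi>. \<Sum>x\<in>orb. of_bool (x \<in> ?N))" by (rule dvd_sum)
  also have "\<dots> = (\<Sum>x\<in>E. of_bool (x \<in> ?N))" by (rule disjoint_sum[OF assms(3)])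
  also have "\<dots> = card ?N" using assms(3) by (simp add: Int_def)
  finally show ?thesis .
qed

text \<open>The centre is the set of fixed points of the action by conjugation.\<close>

lemma (in group) prime_dvd_card_centre:
  assumes "Factorial_Ring.prime p" and "order G = p ^ n" and "0 < n"
  shows "p dvd card (centre G)"
proof -
  have fin: "finite (carrier G)"
    using assms prime_gt_0_nat by (metis order_gt_0_iff_finite zero_less_power)
  interpret conj: group_action G "carrier G" "\<lambda>g. \<lambda>h\<in>carrier G. g \<otimes> h \<otimes> inv g"
    by (rule action_by_conjugation)
  let ?N = "{x \<in> carrier G. \<exists>g\<in>carrier G. (\<lambda>h\<in>carrier G. g \<otimes> h \<otimes> inv g) x \<noteq> x}"
  have "g \<otimes> x \<otimes> inv g = x \<longleftrightarrow> x \<otimes> g = g \<otimes> x" if "g \<in> carrier G" "x \<in> carrier G" for g x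
    using that inv_solve_right'[of x "g \<otimes> x" g] by auto
  then have eq: "carrier G - ?N = centre G"
    by (auto simp: centre_def)
  have "card (centre G) = card (carrier G) - card ?N"
    unfolding eq[symmetric] using fin by (intro card_Diff_subset) auto
  moreover have "p dvd card (carrier G)" using assms(2,3) by (simp add: order_def)
  ultimately show ?thesis
    using conj.prime_dvd_card_non_fixed[OF assms(1,2) fin] by (simp add: dvd_diff_nat)
qed

lemma (in group) subgroup_centralizer:
  assumes "a \<in> carrier G"
  shows "subgroup {x \<in> carrier G. x \<otimes> a = a \<otimes> x} G"
proof (rule subgroupI)
  fix x assume "x \<in> {x \<in> carrier G. x \<otimes> a = a \<otimes> x}"
  then have x: "x \<in> carrier G" "x \<otimes> a = a \<otimes> x" by auto
  then have "inv x \<otimes> a = a \<otimes> inv x"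
    using assms by (metis inv_closed inv_solve_left inv_solve_right m_assoc m_closed)
  then show "inv x \<in> {x \<in> carrier G. x \<otimes> a = a \<otimes> x}" using x by simp
next
  fix x y assume "x \<in> {x \<in> carrier G. x \<otimes> a = a \<otimes> x}" "y \<in> {x \<in> carrier G. x \<otimes> a = a \<otimes> x}"
  then have "x \<in> carrier G" "x \<otimes> a = a \<otimes> x" "y \<in> carrier G" "y \<otimes> a = a \<otimes> y" by auto
  then have "x \<otimes> y \<otimes> a = a \<otimes> (x \<otimes> y)" using assms by (metis m_assoc)
  then show "x \<otimes> y \<in> {x \<in> carrier G. x \<otimes> a = a \<otimes> x}"
    using \<open>x \<in> carrier G\<close> \<open>y \<in> carrier G\<close> by simp
qed (use assms in auto)

lemma (in group) normal_centre: "centre G \<lhd> G"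
proof -
  have "centre G = \<Inter> ((\<lambda>a. {x \<in> carrier G. x \<otimes> a = a \<otimes> x}) ` carrier G)"
    by (auto simp: centre_def)
  moreover have "subgroup (\<Inter> ((\<lambda>a. {x \<in> carrier G. x \<otimes> a = a \<otimes> x}) ` carrier G)) G"
    by (rule subgroups_Inter) (auto intro: subgroup_centralizer)
  ultimately have "subgroup (centre G) G" by simp
  moreover have "x \<otimes> z \<otimes> inv x \<in> centre G" if "x \<in> carrier G" "z \<in> centre G" for x z
  proof -
    have "x \<otimes> z \<otimes> inv x = z"
      using that inv_solve_right'[of z "x \<otimes> z" x] by (auto simp: centre_def)
    then show ?thesis using that by simp
  qed
  ultimately show ?thesis by (simp add: normal_inv_iff)
qed

text \<open>A noncentral element would have a centralizer strictly between the centre and the whole group.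
  As \<open>p\<close> divides the order of the centre, there is no divisor of \<open>p\<^sup>2\<close> left for the order of the
  centralizer.\<close>

lemma (in group) comm_group_of_order_dvd_prime_square:
  assumes "Factorial_Ring.prime p" and "order G dvd p ^ 2"
  shows "comm_group G"
proof (rule ccontr)
  assume "\<not> comm_group G"
  then obtain a b where ab: "a \<in> carrier G" "b \<in> carrier G" "a \<otimes> b \<noteq> b \<otimes> a"
    using group_comm_groupI by blast
  obtain k where k: "order G = p ^ k" "k \<le> 2"
    using assms divides_primepow_nat by blast
  have fin: "finite (carrier G)"
    using assms(1) k prime_gt_0_nat by (metis order_gt_0_iff_finite zero_less_power)
  have "1 < order G"
  proof -
    have "card {a, b} \<le> order G"
      unfolding order_def using ab fin by (intro card_mono) auto
    moreover have "a \<noteq> b" using ab by auto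
    ultimately show ?thesis by simp
  qed
  then have "0 < k" using k by (cases k) auto
  let ?C = "{x \<in> carrier G. x \<otimes> a = a \<otimes> x}"
  have finC: "finite ?C" using fin by simp
  have "centre G \<subset> ?C" using ab by (auto simp: centre_def)
  then have lt: "card (centre G) < card ?C" using finC by (intro psubset_card_mono)
  have "\<one> \<in> centre G" by (simp add: centre_def)
  then have "card (centre G) \<noteq> 0" using fin by (auto simp: centre_def)
  then have "p \<le> card (centre G)"
    using prime_dvd_card_centre[OF assms(1) k(1) \<open>0 < k\<close>] by (auto intro: dvd_imp_le)
  have "card ?C dvd order G"
    unfolding lagrange[OF subgroup_centralizer[OF ab(1)], symmetric] by (rule dvd_triv_right)
  then obtain j where j: "card ?C = p ^ j" "j \<le> k"
    unfolding k(1) divides_primepow_nat[OF assms(1)] by blast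
  have "p ^ 1 < p ^ j" using j lt \<open>p \<le> _\<close> by simp
  then have "1 < j" using prime_gt_1_nat[OF assms(1)] power_strict_increasing_iff[of p 1 j] by simp
  then have "j = k" using j(2) k(2) by linarith
  then have "card ?C = card (carrier G)" using j k by (simp add: order_def)
  then have "?C = carrier G" using fin by (intro card_subset_eq) auto
  then have "b \<in> ?C" using ab by simp
  then show False using ab by simp
qed

text \<open>The order of the centre is a multiple of \<open>p\<close>, so the quotient has order dividing \<open>p\<^sup>2\<close> and is abelian.
  This is stated without commutators, in the form in which it is used for moving
  one factor past another.\<close>

lemma (in group) commutation_mod_centre_of_order_prime_cube:
  assumes "Factorial_Ring.prime p" and "order G = p ^ 3"
    and "x \<in> carrier G" and "y \<in> carrier G"
  shows "\<exists>z\<in>centre G. x \<otimes> y = z \<otimes> (y \<otimes> x)"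
proof -
  interpret Z: normal "centre G" G by (rule normal_centre)
  interpret Q: group "G Mod centre G" by (rule Z.factorgroup_is_group)
  obtain m where m: "card (centre G) = p * m"
    using prime_dvd_card_centre[OF assms(1,2)] by auto
  have "card (rcosets centre G) * (p * m) = p ^ 3"
    using lagrange[OF Z.subgroup_axioms] assms(2) m by simp
  then have "p * (card (rcosets centre G) * m) = p * p ^ 2"
    by (simp add: power2_eq_square power3_eq_cube algebra_simps)
  then have "card (rcosets centre G) * m = p ^ 2"
    using prime_gt_0_nat[OF assms(1)] by simp
  then have "order (G Mod centre G) dvd p ^ 2"
    by (simp add: order_def FactGroup_def) (metis dvd_triv_left)
  then interpret Q: comm_group "G Mod centre G"
    by (rule Q.comm_group_of_order_dvd_prime_square[OF assms(1)])
  have "(centre G #> x) \<otimes>\<^bsub>G Mod centre G\<^esub> (centre G #> y) =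
        (centre G #> y) \<otimes>\<^bsub>G Mod centre G\<^esub> (centre G #> x)"
    using assms(3,4) by (intro Q.m_comm) (auto simp: FactGroup_def RCOSETS_def)
  then have "centre G #> (x \<otimes> y) = centre G #> (y \<otimes> x)"
    using assms(3,4) by (simp add: FactGroup_def Z.rcos_sum)
  moreover have "x \<otimes> y \<in> centre G #> (x \<otimes> y)"
    using assms(3,4) by (intro rcos_self Z.subgroup_axioms) simp
  ultimately have "x \<otimes> y \<in> centre G #> (y \<otimes> x)" by simp
  then show ?thesis by (auto simp: r_coset_def)
qed

section \<open>Recognising the Heisenberg group\<close>

lemma (in group) nat_pow_mod_exponent:
  assumes "x \<in> carrier G" and "x [^] p = \<one>"
  shows "x [^] (n mod p) = x [^] (n :: nat)"
proof -
  have "x [^] n = x [^] (p * (n div p) + n mod p)" by simp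
  also have "\<dots> = (x [^] p) [^] (n div p) \<otimes> x [^] (n mod p)"
    using assms(1) by (simp only: nat_pow_mult nat_pow_pow)
  finally show ?thesis using assms by simp
qed

lemma (in group) nat_pow_eq_one_iff_prime_dvd:
  assumes "Factorial_Ring.prime p" and "x \<in> carrier G" and "x [^] p = \<one>" and "x \<noteq> \<one>"
  shows "x [^] (n :: nat) = \<one> \<longleftrightarrow> p dvd n"
proof -
  have "ord x dvd p" using assms(2,3) by (simp add: pow_eq_id[symmetric])
  moreover have "ord x \<noteq> 1" using assms(2,4) ord_eq_1 by blast
  ultimately have "ord x = p" using prime_nat_iff[of p] assms(1) by blast
  then show ?thesis using assms(2) by (simp add: pow_eq_id)
qed

text \<open>Moving one \<open>a\<close> past one \<open>b\<close> costs one central factor \<open>c\<close>, and there are \<open>i * j\<close> such exchanges.\<close>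

lemma (in group) commute_nat_pow_central:
  assumes "a \<in> carrier G" and "b \<in> carrier G" and "c \<in> centre G" and "a \<otimes> b = c \<otimes> (b \<otimes> a)"
  shows "a [^] (i :: nat) \<otimes> b [^] (j :: nat) = b [^] j \<otimes> a [^] i \<otimes> c [^] (i * j)"
proof -
  have c: "c \<in> carrier G" and comm: "\<And>x. x \<in> carrier G \<Longrightarrow> c \<otimes> x = x \<otimes> c"
    using assms(3) by (auto simp: centre_def)
  have powcomm: "c [^] k \<otimes> x = x \<otimes> c [^] k" if "x \<in> carrier G" for x and k :: nat
    using group_commutes_pow[OF comm[OF that] c that] .
  have ab: "a \<otimes> b = b \<otimes> a \<otimes> c"
    using assms comm[of "b \<otimes> a"] by simp
  have step: "a \<otimes> b [^] j = b [^] j \<otimes> a \<otimes> c [^] j" for j :: nat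
  proof (induction j)
    case (Suc j)
    have "a \<otimes> b [^] Suc j = (a \<otimes> b [^] j) \<otimes> b" using assms by (simp add: m_assoc)
    also have "\<dots> = b [^] j \<otimes> a \<otimes> (c [^] j \<otimes> b)" using Suc assms c by (simp add: m_assoc)
    also have "\<dots> = b [^] j \<otimes> (a \<otimes> b) \<otimes> c [^] j"
      using assms(1,2) c by (simp add: powcomm[of b] m_assoc)
    also have "\<dots> = b [^] j \<otimes> (b \<otimes> a \<otimes> c) \<otimes> c [^] j" by (simp only: ab)
    also have "\<dots> = (b [^] j \<otimes> b) \<otimes> a \<otimes> (c \<otimes> c [^] j)"
      using assms(1,2) c by (simp add: m_assoc)
    also have "\<dots> = b [^] Suc j \<otimes> a \<otimes> c [^] Suc j"
      using c by (simp only: nat_pow_Suc2[of c]) simp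
    finally show ?case .
  qed (use assms in simp)
  show ?thesis
  proof (induction i)
    case (Suc i)
    have "a [^] Suc i \<otimes> b [^] j = a [^] i \<otimes> (a \<otimes> b [^] j)" using assms by (simp add: m_assoc)
    also have "\<dots> = (a [^] i \<otimes> b [^] j) \<otimes> (a \<otimes> c [^] j)"
      using assms(1,2) c by (simp add: step m_assoc)
    also have "\<dots> = b [^] j \<otimes> a [^] i \<otimes> (c [^] (i * j) \<otimes> a) \<otimes> c [^] j"
      using Suc assms(1,2) c by (simp add: m_assoc)
    also have "\<dots> = b [^] j \<otimes> a [^] Suc i \<otimes> (c [^] (i * j) \<otimes> c [^] j)"
      using assms(1,2) c by (simp add: powcomm[of a] m_assoc)
    also have "\<dots> = b [^] j \<otimes> a [^] Suc i \<otimes> c [^] (Suc i * j)"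
      using c by (simp add: nat_pow_mult add.commute del: nat_pow_Suc)
    finally show ?case .
  qed (use assms in simp)
qed

text \<open>With \<open>a \<otimes> b = c \<otimes> b \<otimes> a\<close> and \<open>c\<close> central, the words \<open>b\<^sup>j a\<^sup>i c\<^sup>k\<close> multiply by the law of the
  Heisenberg group; \<open>b\<close> stands first because the twist in that law is the first coordinate of
  the left factor times the second coordinate of the right one. A word equal to \<open>1\<close> commutes
  with \<open>a\<close> and \<open>b\<close>, which forces \<open>c\<^sup>j = c\<^sup>i = 1\<close>, so that all its exponents are divisible by \<open>p\<close>.
  Equality of orders gives surjectivity.\<close>

lemma (in group) heisenberg_iso_if_nonabelian_of_order_prime_cube:
  assumes p: "Factorial_Ring.prime p" and "\<not> comm_group G" and "order G = p ^ 3"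
    and exp: "\<And>x. x \<in> carrier G \<Longrightarrow> x [^] p = \<one>"
  shows "\<exists>h. h \<in> iso (heisenberg p) G"
proof -
  have p0: "p > 0" using p prime_gt_0_nat by blast
  obtain a b where ab: "a \<in> carrier G" "b \<in> carrier G" "a \<otimes> b \<noteq> b \<otimes> a"
    using assms(2) group_comm_groupI by blast
  obtain c where cZ: "c \<in> centre G" and c: "a \<otimes> b = c \<otimes> (b \<otimes> a)"
    using commutation_mod_centre_of_order_prime_cube[OF p assms(3) ab(1,2)] by blast
  have cG: "c \<in> carrier G" and comm: "\<And>x. x \<in> carrier G \<Longrightarrow> c \<otimes> x = x \<otimes> c"
    using cZ by (auto simp: centre_def)
  have c1: "c \<noteq> \<one>" using c ab by auto
  have powcomm: "c [^] k \<otimes> x = x \<otimes> c [^] k" if "x \<in> carrier G" for x and k :: nat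
    using group_commutes_pow[OF comm[OF that] cG that] .
  have c_pow: "c [^] k = \<one> \<longleftrightarrow> p dvd k" for k :: nat
    using nat_pow_eq_one_iff_prime_dvd[OF p cG exp[OF cG] c1] .
  define w where "w i j k = b [^] j \<otimes> a [^] i \<otimes> c [^] k" for i j k :: nat
  have w_closed: "w i j k \<in> carrier G" for i j k
    using ab cG by (simp add: w_def)
  have w_mult: "w i j k \<otimes> w i' j' k' = w (i + i') (j + j') (k + k' + i * j')" for i j k i' j' k'
  proof -
    have "w i j k \<otimes> w i' j' k' = b [^] j \<otimes> (a [^] i \<otimes> (c [^] k \<otimes> (b [^] j' \<otimes> a [^] i'))) \<otimes> c [^] k'"
      using ab cG by (simp add: w_def m_assoc)
    also have "\<dots> = b [^] j \<otimes> (a [^] i \<otimes> b [^] j') \<otimes> a [^] i' \<otimes> (c [^] k \<otimes> c [^] k')"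
      using ab cG by (simp add: powcomm[of "b [^] j' \<otimes> a [^] i'"] m_assoc)
    also have "\<dots> = b [^] j \<otimes> (b [^] j' \<otimes> a [^] i \<otimes> c [^] (i * j')) \<otimes> a [^] i' \<otimes> c [^] (k + k')"
      using ab cG commute_nat_pow_central[OF ab(1,2) cZ c] by (simp add: nat_pow_mult)
    also have "\<dots> = (b [^] j \<otimes> b [^] j') \<otimes> (a [^] i \<otimes> (c [^] (i * j') \<otimes> a [^] i')) \<otimes> c [^] (k + k')"
      using ab cG by (simp add: m_assoc)
    also have "\<dots> = (b [^] j \<otimes> b [^] j') \<otimes> (a [^] i \<otimes> a [^] i') \<otimes> (c [^] (i * j') \<otimes> c [^] (k + k'))"
      using ab cG by (simp add: powcomm[of "a [^] i'"] m_assoc)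
    also have "\<dots> = w (i + i') (j + j') (k + k' + i * j')"
      using ab cG by (simp add: w_def nat_pow_mult add.commute)
    finally show ?thesis .
  qed
  have w_mod: "w (i mod p) (j mod p) (k mod p) = w i j k" for i j k
    using ab cG by (simp add: w_def nat_pow_mod_exponent exp)
  have w_one: "p dvd i \<and> p dvd j \<and> p dvd k" if "w i j k = \<one>" for i j k
  proof -
    have w1: "w 0 (Suc 0) 0 = b" "w (Suc 0) 0 0 = a" "w 0 0 n = c [^] n" for n
      using ab cG by (simp_all add: w_def)
    have w_c: "w r s t \<otimes> c [^] n = w r s (t + n)" for r s t n
      using w_mult[of r s t 0 0 n] w1 by simp
    \<comment> \<open>Comparing the products with \<open>b\<close> on either side isolates \<open>c\<^sup>i\<close>; with \<open>a\<close>, it isolates \<open>c\<^sup>j\<close>.\<close>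
    have "w i j k \<otimes> b = b \<otimes> w i j k \<otimes> c [^] i"
      using w_mult[of i j k 0 1 0] w_mult[of 0 1 0 i j k] by (simp add: w1 w_c)
    then have "c [^] i = \<one>" using that ab cG by (simp add: l_cancel_one')
    moreover have "a \<otimes> w i j k = w i j k \<otimes> a \<otimes> c [^] j"
      using w_mult[of i j k 1 0 0] w_mult[of 1 0 0 i j k] by (simp add: w1 w_c)
    then have "c [^] j = \<one>" using that ab cG by (simp add: l_cancel_one')
    ultimately have ij: "p dvd i" "p dvd j" by (simp_all add: c_pow)
    then have "w i j k = w 0 0 k" using w_mod[of i j k] w_mod[of 0 0 k] by simp
    then have "c [^] k = \<one>" using that w1 by simp
    then show ?thesis using ij by (simp add: c_pow)
  qed
  define h where "h = (\<lambda>(i, j, k). w (nat i) (nat j) (nat k))"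
  interpret P: group "heisenberg p" by (rule group_heisenberg[OF p0])
  have h_hom: "h \<in> hom (heisenberg p) G"
  proof (rule homI)
    fix x y assume x: "x \<in> carrier (heisenberg p)" and y: "y \<in> carrier (heisenberg p)"
    obtain i j k i' j' k' where xy: "x = (i, j, k)" "y = (i', j', k')"
      using prod_cases3 by metis
    have nn: "0 \<le> i" "0 \<le> j" "0 \<le> k" "0 \<le> i'" "0 \<le> j'" "0 \<le> k'"
      using x y by (auto simp: xy heisenberg_def)
    have "h (x \<otimes>\<^bsub>heisenberg p\<^esub> y) =
        w ((nat i + nat i') mod p) ((nat j + nat j') mod p) ((nat k + nat k' + nat i * nat j') mod p)"
      using nn by (simp add: h_def xy heisenberg_def nat_mod_distrib nat_add_distrib nat_mult_distrib)
    then show "h (x \<otimes>\<^bsub>heisenberg p\<^esub> y) = h x \<otimes> h y"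
      by (simp add: w_mod w_mult h_def xy)
  qed (auto simp: h_def w_closed)
  interpret h: group_hom "heisenberg p" G h
    by unfold_locales (rule h_hom)
  have "inj_on h (carrier (heisenberg p))"
    unfolding h.inj_on_one_iff
  proof (intro allI impI)
    fix x assume x: "x \<in> carrier (heisenberg p)" and "h x = \<one>"
    obtain i j k where xe: "x = (i, j, k)" using prod_cases3 by metis
    have "p dvd nat i" "p dvd nat j" "p dvd nat k"
      using w_one \<open>h x = \<one>\<close> by (auto simp: h_def xe)
    moreover have "0 \<le> i" "i < int p" "0 \<le> j" "j < int p" "0 \<le> k" "k < int p"
      using x by (auto simp: xe heisenberg_def)
    moreover have "n = 0" if "p dvd nat n" "0 \<le> n" "n < int p" for n
      using that by (metis nat_0_iff nat_dvd_not_less nat_less_iff not_gr_zero order_antisym)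
    ultimately show "x = \<one>\<^bsub>heisenberg p\<^esub>" by (simp add: xe heisenberg_def)
  qed
  moreover have "card (carrier (heisenberg p)) = card (carrier G)"
    using assms(3) by (simp add: order_def heisenberg_def card_cartesian_product power3_eq_cube)
  moreover have "finite (carrier G)"
    using assms(3) p0 by (metis order_gt_0_iff_finite zero_less_power)
  moreover have "h ` carrier (heisenberg p) \<subseteq> carrier G" by auto
  ultimately have "bij_betw h (carrier (heisenberg p)) (carrier G)"
    unfolding bij_betw_def by (simp add: card_image card_subset_eq)
  then have "h \<in> iso (heisenberg p) G" using h_hom by (simp add: iso_def)
  then show ?thesis by blast
qed

section \<open>Endomorphisms of the elementary abelian and the Heisenberg group\<close>

text \<open>The homomorphism is \<open>t \<mapsto> y\<^bsup>u \<chi>(t)\<^esup>\<close>, where \<open>u\<close> inverts \<open>\<chi>(x)\<close> modulo \<open>p\<close>; it is well behaved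
  modulo \<open>p\<close> because \<open>y\<^sup>p = 1\<close>.\<close>

lemma (in group) hom_through_character:
  assumes "Factorial_Ring.prime p" and \<chi>: "\<chi> \<in> hom K (integer_mod_group p)"
    and "x \<in> carrier K" and "\<chi> x \<noteq> 0" and y: "y \<in> carrier G" "y [^] p = \<one>"
  shows "\<exists>f\<in>hom K G. f x = y"
proof -
  have p: "p > 1" using assms(1) prime_gt_1_nat by blast
  have range: "0 \<le> \<chi> t" "\<chi> t < int p" if "t \<in> carrier K" for t
    using \<chi> that p by (force simp: hom_def carrier_integer_mod_group)+
  have "\<not> p dvd nat (\<chi> x)"
    using range[OF assms(3)] assms(4) by (auto dest!: dvd_imp_le)
  then have "coprime (nat (\<chi> x)) p"
    using assms(1) by (simp add: prime_imp_coprime coprime_commute)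
  then obtain u where u: "[nat (\<chi> x) * u = 1] (mod p)"
    using cong_solve_coprime_nat by auto
  define f where "f t = y [^] (nat (\<chi> t) * u)" for t
  have "f \<in> hom K G"
  proof (rule homI)
    fix s t assume st: "s \<in> carrier K" "t \<in> carrier K"
    have "\<chi> (s \<otimes>\<^bsub>K\<^esub> t) = (\<chi> s + \<chi> t) mod int p"
      using \<chi> st by (simp add: hom_def)
    then have "nat (\<chi> (s \<otimes>\<^bsub>K\<^esub> t)) = (nat (\<chi> s) + nat (\<chi> t)) mod p"
      using range st by (simp add: nat_mod_distrib nat_add_distrib)
    then have "nat (\<chi> (s \<otimes>\<^bsub>K\<^esub> t)) * u mod p = (nat (\<chi> s) * u + nat (\<chi> t) * u) mod p"
      by (simp add: mod_mult_left_eq distrib_right)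
    then show "f (s \<otimes>\<^bsub>K\<^esub> t) = f s \<otimes> f t"
      unfolding f_def using y by (metis nat_pow_mod_exponent nat_pow_mult)
  qed (simp add: f_def y)
  moreover have "f x = y"
  proof -
    have "nat (\<chi> x) * u mod p = 1" using u p by (simp add: cong_def)
    then show ?thesis
      unfolding f_def using y nat_pow_mod_exponent[of y p "nat (\<chi> x) * u"] by simp
  qed
  ultimately show ?thesis by blast
qed

lemma group_Z_mod_cube: "group (Z_mod_cube p)"
  by (simp add: Z_mod_cube_def DirProd_group)

lemma carrier_Z_mod_cube:
  "p > 0 \<Longrightarrow> carrier (Z_mod_cube p) = {0..<int p} \<times> {0..<int p} \<times> {0..<int p}"
  by (simp add: Z_mod_cube_def carrier_integer_mod_group)

lemma Z_mod_cube_hom_exists: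
  assumes "Factorial_Ring.prime p" and "x \<in> carrier (Z_mod_cube p)" and "x \<noteq> (0, 0, 0)"
    and "y \<in> carrier (Z_mod_cube p)"
  shows "\<exists>f\<in>hom (Z_mod_cube p) (Z_mod_cube p). f x = y"
proof -
  interpret group "Z_mod_cube p" by (rule group_Z_mod_cube)
  have "(a, b, c) [^]\<^bsub>Z_mod_cube p\<^esub> n = ((int n * a) mod int p, (int n * b) mod int p, (int n * c) mod int p)"
    for a b c and n :: nat
    by (induction n) (simp_all add: Z_mod_cube_def mod_simps algebra_simps)
  then have exp: "y [^]\<^bsub>Z_mod_cube p\<^esub> p = \<one>\<^bsub>Z_mod_cube p\<^esub>"
    by (cases y) (simp add: Z_mod_cube_def)
  have proj: "fst \<in> hom (Z_mod_cube p) (integer_mod_group p)"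
    "(\<lambda>t. fst (snd t)) \<in> hom (Z_mod_cube p) (integer_mod_group p)"
    "(\<lambda>t. snd (snd t)) \<in> hom (Z_mod_cube p) (integer_mod_group p)"
    by (auto simp: hom_def Z_mod_cube_def)
  have "fst x \<noteq> 0 \<or> fst (snd x) \<noteq> 0 \<or> snd (snd x) \<noteq> 0"
    using assms(3) by (cases x) auto
  then show ?thesis
    using proj[THEN hom_through_character[OF assms(1) _ assms(2) _ assms(4) exp]] by blast
qed

lemma heisenberg_hom_exists_if_noncentral:
  assumes "Factorial_Ring.prime p" and "odd p" and "x \<in> carrier (heisenberg p)"
    and "y \<in> carrier (heisenberg p)" and "fst x \<noteq> 0 \<or> fst (snd x) \<noteq> 0"
  shows "\<exists>f\<in>hom (heisenberg p) (heisenberg p). f x = y"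
proof -
  interpret group "heisenberg p" using heisenberg_order_exponent(1)[OF assms(1,2)] .
  have exp: "y [^]\<^bsub>heisenberg p\<^esub> p = \<one>\<^bsub>heisenberg p\<^esub>"
    using heisenberg_order_exponent(4)[OF assms(1,2)] assms(4) by (simp add: has_exponent_def)
  have proj: "fst \<in> hom (heisenberg p) (integer_mod_group p)"
    "(\<lambda>t. fst (snd t)) \<in> hom (heisenberg p) (integer_mod_group p)"
    by (auto simp: hom_def heisenberg_def carrier_integer_mod_group)
  then show ?thesis
    using proj[THEN hom_through_character[OF assms(1) _ assms(3) _ assms(4) exp]] assms(5) by blast
qed

text \<open>Scaling the second and third coordinates respects the twist \<open>a * b'\<close>, which is linear in \<open>b'\<close>. These maps
  carry a nontrivial central element to any central element.\<close>

lemma heisenberg_scaling_hom: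
  assumes "p > 0"
  shows "(\<lambda>(a, b, c). (a, (k * b) mod int p, (k * c) mod int p)) \<in> hom (heisenberg p) (heisenberg p)"
proof -
  have "k * ((c + c' + a * b') mod int p) mod int p =
      (k * c mod int p + k * c' mod int p + a * (k * b' mod int p)) mod int p" for a c b' c'
  proof -
    have "(k * c mod int p + k * c' mod int p + a * (k * b' mod int p)) mod int p =
        (k * c + k * c' + a * (k * b')) mod int p"
      by (intro mod_add_cong mod_mult_cong refl mod_mod_trivial)
    also have "\<dots> = k * (c + c' + a * b') mod int p" by (simp add: algebra_simps)
    finally show ?thesis by (simp add: mod_mult_right_eq)
  qed
  then show ?thesis
    using assms by (auto simp: hom_def heisenberg_def mod_simps distrib_left)
qed

text \<open>The element \<open>(0, 0, c)\<close> is the commutator of \<open>(c, 0, 0)\<close> and \<open>(0, 1, 0)\<close>, so its image is a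
  commutator as well, and the first two coordinates, being additive, vanish on commutators.\<close>

lemma heisenberg_hom_central:
  assumes "p > 1" and f: "f \<in> hom (heisenberg p) (heisenberg p)" and c: "0 \<le> c" "c < int p"
  shows "fst (f (0, 0, c)) = 0 \<and> fst (snd (f (0, 0, c))) = 0"
proof -
  let ?H = "heisenberg p"
  let ?z = "(0, 0, c)" and ?a = "(c, 0, 0)" and ?b = "(0, 1, 0) :: int \<times> int \<times> int"
  have mem: "?z \<in> carrier ?H" "?a \<in> carrier ?H" "?b \<in> carrier ?H"
    using assms by (auto simp: heisenberg_def)
  have "?a \<otimes>\<^bsub>?H\<^esub> ?b = ?z \<otimes>\<^bsub>?H\<^esub> (?b \<otimes>\<^bsub>?H\<^esub> ?a)"
    using assms by (simp add: heisenberg_def)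
  moreover have "?b \<otimes>\<^bsub>?H\<^esub> ?a \<in> carrier ?H"
    using assms by (auto simp: heisenberg_def)
  ultimately have eq: "f ?a \<otimes>\<^bsub>?H\<^esub> f ?b = f ?z \<otimes>\<^bsub>?H\<^esub> (f ?b \<otimes>\<^bsub>?H\<^esub> f ?a)"
    using mem by (metis hom_mult[OF f])
  obtain z1 z2 z3 a1 a2 a3 b1 b2 b3 where
    fe: "f ?z = (z1, z2, z3)" "f ?a = (a1, a2, a3)" "f ?b = (b1, b2, b3)"
    using prod_cases3 by metis
  have "f ?z \<in> carrier ?H" using f mem(1) by (auto simp: hom_def)
  then have range: "0 \<le> z1" "z1 < int p" "0 \<le> z2" "z2 < int p"
    by (auto simp: fe heisenberg_def)
  have zero: "u = 0" if "(s + t) mod int p = (u + (t + s)) mod int p" "0 \<le> u" "u < int p" for s t u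
  proof -
    have "int p dvd (u + (t + s)) - (s + t)" using that(1) by (metis mod_eq_dvd_iff)
    then have "int p dvd u" by simp
    then show ?thesis using that(2,3) zdvd_not_zless by force
  qed
  have "(a1 + b1) mod int p = (z1 + (b1 + a1)) mod int p"
    "(a2 + b2) mod int p = (z2 + (b2 + a2)) mod int p"
    using eq by (simp_all add: fe heisenberg_def mod_simps)
  then show ?thesis using zero range by (simp add: fe)
qed

text \<open>If one of the two elements is noncentral, it can be mapped to the other. If both are
  central, one of them is not the identity, and a scaling takes it to the other.\<close>

lemma heisenberg_arc_total:
  assumes "Factorial_Ring.prime p" and "odd p" and x: "x \<in> carrier (heisenberg p)"
    and y: "y \<in> carrier (heisenberg p)" and "x \<noteq> y"
  shows "(x, y) \<in> parcs (endomorphism_digraph (heisenberg p)) \<or>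
         (y, x) \<in> parcs (endomorphism_digraph (heisenberg p))"
proof -
  let ?E = "\<lambda>x y. \<exists>f\<in>hom (heisenberg p) (heisenberg p). f x = y"
  have p: "p > 0" using assms(1) prime_gt_0_nat by blast
  have central: "?E (0, 0, c) (0, 0, d)"
    if c: "0 < c" "c < int p" and d: "0 \<le> d" "d < int p" for c d
  proof -
    have "\<not> int p dvd c" using c by (simp add: zdvd_not_zless)
    moreover have "Factorial_Ring.prime (int p)" using assms(1) by simp
    ultimately have "coprime c (int p)"
      using prime_imp_coprime[of "int p" c] by (simp add: coprime_commute)
    then obtain u where "[c * u = 1] (mod int p)" using cong_solve_coprime_int by blast
    \<comment> \<open>The scaling factor that takes \<open>c\<close> to \<open>d\<close> is \<open>d * u\<close>, with \<open>u\<close> inverse to \<open>c\<close> modulo \<open>p\<close>.\<close>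
    then have "[d * (c * u) = d * 1] (mod int p)" by (rule cong_scalar_left)
    then have "(d * u) * c mod int p = d" using d by (simp add: cong_def mult_ac)
    then have "(\<lambda>(a, b, e). (a, (d * u) * b mod int p, (d * u) * e mod int p)) (0, 0, c) = (0, 0, d)"
      by simp
    then show ?thesis using heisenberg_scaling_hom[OF p, of "d * u"] by (rule bexI)
  qed
  have "?E x y \<or> ?E y x"
  proof (cases "fst x = 0 \<and> fst (snd x) = 0 \<and> fst y = 0 \<and> fst (snd y) = 0")
    case True
    then obtain c d where cd: "x = (0, 0, c)" "y = (0, 0, d)"
      by (cases x, cases y) auto
    then have "0 \<le> c" "c < int p" "0 \<le> d" "d < int p" "c \<noteq> d"
      using x y assms(5) by (auto simp: heisenberg_def)
    then show ?thesis
      using central[of c d] central[of d c] unfolding cd by (cases "c = 0") auto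
  next
    case False
    then show ?thesis
      using heisenberg_hom_exists_if_noncentral[OF assms(1,2)] x y by blast
  qed
  then show ?thesis using x y assms(5) by (auto simp: endomorphism_digraph_def)
qed

section \<open>Isomorphisms of digraphs without parallel arcs\<close>

text \<open>An isomorphism in the sense of \<open>digraph_iso\<close> carries separate data for vertices, arcs, heads and
  tails. When arcs are pairs of vertices, the action on the arcs is determined by
  the action on the vertices.\<close>

lemma digraph_iso_with_proj_iff:
  assumes "wf_digraph (with_proj G)" and "wf_digraph (with_proj K)"
  shows "digraph_iso (with_proj G) (with_proj K) \<longleftrightarrow>
    (\<exists>h. bij_betw h (pverts G) (pverts K) \<and>
      (\<forall>x\<in>pverts G. \<forall>y\<in>pverts G. (x, y) \<in> parcs G \<longleftrightarrow> (h x, h y) \<in> parcs K))"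
    (is "_ \<longleftrightarrow> ?rhs")
proof
  assume "digraph_iso (with_proj G) (with_proj K)"
  then obtain f where f: "pre_digraph.digraph_isomorphism (with_proj G) f"
    and K: "with_proj K = app_iso f (with_proj G)"
    by (auto simp: digraph_iso_def)
  let ?h = "iso_verts f"
  have inj: "inj_on ?h (pverts G)"
    using f by (simp add: pre_digraph.digraph_isomorphism_def)
  have verts: "pverts K = ?h ` pverts G" and arcs: "parcs K = iso_arcs f ` parcs G"
    and tail: "iso_tail f = fst" and head: "iso_head f = snd"
    using arg_cong[OF K, of verts] arg_cong[OF K, of arcs] arg_cong[OF K, of tail]
      arg_cong[OF K, of head] by simp_all
  have "iso_arcs f (x, y) = (?h x, ?h y)" if "(x, y) \<in> parcs G" for x y
    using f that by (auto simp: pre_digraph.digraph_isomorphism_def tail head prod_eq_iff)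
  then have arcs': "parcs K = map_prod ?h ?h ` parcs G"
    unfolding arcs by (intro image_cong) auto
  have sub: "parcs G \<subseteq> pverts G \<times> pverts G"
    using wf_digraph.tail_in_verts[OF assms(1)] wf_digraph.head_in_verts[OF assms(1)] by force
  have "(x, y) \<in> parcs G \<longleftrightarrow> (?h x, ?h y) \<in> parcs K" if "x \<in> pverts G" "y \<in> pverts G" for x y
    unfolding arcs' using that inj sub by (auto dest: inj_onD)
  then show ?rhs using inj verts by (auto simp: bij_betw_def)
next
  assume ?rhs
  then obtain h where h: "bij_betw h (pverts G) (pverts K)"
    and iff: "\<And>x y. x \<in> pverts G \<Longrightarrow> y \<in> pverts G \<Longrightarrow> (x, y) \<in> parcs G \<longleftrightarrow> (h x, h y) \<in> parcs K"
    by blast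
  have sub: "parcs G \<subseteq> pverts G \<times> pverts G" "parcs K \<subseteq> pverts K \<times> pverts K"
    using wf_digraph.tail_in_verts[OF assms(1)] wf_digraph.head_in_verts[OF assms(1)]
      wf_digraph.tail_in_verts[OF assms(2)] wf_digraph.head_in_verts[OF assms(2)] by force+
  let ?f = "\<lparr>iso_verts = h, iso_arcs = map_prod h h, iso_head = snd, iso_tail = fst\<rparr>"
  have "inj_on (map_prod h h) (parcs G)"
    using h sub(1) by (auto simp: bij_betw_def intro!: inj_on_subset[OF map_prod_inj_on])
  then have "pre_digraph.digraph_isomorphism (with_proj G) ?f"
    using h assms(1) by (simp add: pre_digraph.digraph_isomorphism_def bij_betw_def)
  moreover have "parcs K = map_prod h h ` parcs G"
  proof (intro equalityI subsetI)
    fix e assume e: "e \<in> parcs K"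
    then have "fst e \<in> h ` pverts G" "snd e \<in> h ` pverts G"
      using sub(2) h by (auto simp: bij_betw_def)
    then obtain x y where "x \<in> pverts G" "y \<in> pverts G" "e = (h x, h y)"
      by (metis imageE prod.collapse)
    then show "e \<in> map_prod h h ` parcs G" using e iff by force
  next
    fix e assume "e \<in> map_prod h h ` parcs G"
    then show "e \<in> parcs K" using iff sub(1) by auto
  qed
  then have "with_proj K = app_iso ?f (with_proj G)"
    using h by (simp add: with_proj_def app_iso_def bij_betw_def)
  ultimately show "digraph_iso (with_proj G) (with_proj K)"
    by (auto simp: digraph_iso_def)
qed

lemma endomorphism_graphs_iso_if_complete:
  assumes "bij_betw h (carrier G) (carrier K)"
    and "\<And>x y. x \<in> carrier G \<Longrightarrow> y \<in> carrier G \<Longrightarrow> x \<noteq> y \<Longrightarrow>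
      (x, y) \<in> parcs (endomorphism_digraph G) \<or> (y, x) \<in> parcs (endomorphism_digraph G)"
    and "\<And>x y. x \<in> carrier K \<Longrightarrow> y \<in> carrier K \<Longrightarrow> x \<noteq> y \<Longrightarrow>
      (x, y) \<in> parcs (endomorphism_digraph K) \<or> (y, x) \<in> parcs (endomorphism_digraph K)"
  shows "digraph_iso (with_proj (endomorphism_graph G)) (with_proj (endomorphism_graph K))"
proof -
  have verts: "pverts (endomorphism_graph L) = carrier L" for L :: "('x, 'y) monoid_scheme"
    by (simp add: endomorphism_graph_def endomorphism_digraph_def)
  have "(x, y) \<in> parcs (endomorphism_graph G) \<longleftrightarrow> x \<noteq> y" if "x \<in> carrier G" "y \<in> carrier G" for x y
    using assms(2)[of x y] that by (auto simp: endomorphism_graph_arc_iff endomorphism_digraph_def)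
  moreover have "(x, y) \<in> parcs (endomorphism_graph K) \<longleftrightarrow> x \<noteq> y"
    if "x \<in> carrier K" "y \<in> carrier K" for x y
    using assms(3)[of x y] that by (auto simp: endomorphism_graph_arc_iff endomorphism_digraph_def)
  moreover have "h x \<in> carrier K" "h x = h y \<longleftrightarrow> x = y" if "x \<in> carrier G" "y \<in> carrier G" for x y
    using assms(1) that by (auto simp: bij_betw_def dest: inj_onD)
  ultimately have "\<forall>x\<in>carrier G. \<forall>y\<in>carrier G. (x, y) \<in> parcs (endomorphism_graph G) \<longleftrightarrow>
      (h x, h y) \<in> parcs (endomorphism_graph K)"
    by simp
  then show ?thesis
    using assms(1) unfolding digraph_iso_with_proj_iff[OF wf_endomorphism_graph wf_endomorphism_graph] verts
    by blast
qed

text \<open>Conjugating by \<open>h\<close> turns endomorphisms of \<open>G\<close> into endomorphisms of \<open>K\<close>, and conversely.\<close>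

lemma endomorphism_digraph_arc_iso:
  assumes "group G" and h: "h \<in> iso G K" and xy: "x \<in> carrier G" "y \<in> carrier G"
  shows "(x, y) \<in> parcs (endomorphism_digraph G) \<longleftrightarrow> (h x, h y) \<in> parcs (endomorphism_digraph K)"
proof -
  have bij: "bij_betw h (carrier G) (carrier K)" and hom: "h \<in> hom G K"
    using h by (auto simp: iso_def)
  let ?g = "inv_into (carrier G) h"
  have g: "?g \<in> hom K G"
    using group.iso_set_sym[OF assms(1) h] by (auto simp: iso_def)
  have gh: "?g (h t) = t" if "t \<in> carrier G" for t
    using bij that by (auto simp: bij_betw_def inv_into_f_f)
  have hg: "h (?g t) = t" if "t \<in> carrier K" for t
    using bij that by (auto simp: bij_betw_def f_inv_into_f)
  have "(\<exists>f\<in>hom G G. f x = y) \<longleftrightarrow> (\<exists>f\<in>hom K K. f (h x) = h y)"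
  proof
    assume "\<exists>f\<in>hom G G. f x = y"
    then obtain f where f: "f \<in> hom G G" "f x = y" by blast
    have "h \<circ> (f \<circ> ?g) \<in> hom K K" by (rule hom_compose[OF hom_compose[OF g f(1)] hom])
    then show "\<exists>f\<in>hom K K. f (h x) = h y"
      using f(2) gh xy by (intro bexI[of _ "h \<circ> (f \<circ> ?g)"]) simp_all
  next
    assume "\<exists>f\<in>hom K K. f (h x) = h y"
    then obtain f where f: "f \<in> hom K K" "f (h x) = h y" by blast
    have "?g \<circ> (f \<circ> h) \<in> hom G G" by (rule hom_compose[OF hom_compose[OF hom f(1)] g])
    then show "\<exists>f\<in>hom G G. f x = y"
      using f(2) gh xy by (intro bexI[of _ "?g \<circ> (f \<circ> h)"]) simp_all
  qed
  moreover have "h x = h y \<longleftrightarrow> x = y" using bij xy by (auto simp: bij_betw_def dest: inj_onD)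
  moreover have "h x \<in> carrier K" "h y \<in> carrier K" using bij xy by (auto simp: bij_betw_def)
  ultimately show ?thesis using xy by (simp add: endomorphism_digraph_def)
qed

section \<open>Comparison of the endomorphism graphs and digraphs\<close>

theorem proposition9p3:
  fixes p :: nat and H :: "('a, 'm) monoid_scheme"
  assumes "Factorial_Ring.prime p" and "odd p"
    and "group H" and "\<not> comm_group H"
    and "order H = p ^ 3" and "has_exponent H p"
  shows "digraph_iso (with_proj (endomorphism_graph H)) (with_proj (endomorphism_graph (Z_mod_cube p))) \<and>
         \<not> digraph_iso (with_proj (endomorphism_digraph H)) (with_proj (endomorphism_digraph (Z_mod_cube p)))"
proof -
  let ?Z = "Z_mod_cube p" and ?U = "heisenberg p"
  have p: "p > 1" "p > 0" using assms(1) prime_gt_1_nat prime_gt_0_nat by blast+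
  obtain h where h: "h \<in> iso ?U H"
    using group.heisenberg_iso_if_nonabelian_of_order_prime_cube[OF assms(3,1,4,5)] assms(6)
    unfolding has_exponent_def by blast
  then have h_bij: "bij_betw h (carrier ?U) (carrier H)" by (simp add: iso_def)
  then have h_surj: "h ` carrier ?U = carrier H" by (simp add: bij_betw_def)
  note h_arc = endomorphism_digraph_arc_iso[OF group_heisenberg[OF p(2)] h]
  have Z_arc: "(x, y) \<in> parcs (endomorphism_digraph ?Z)"
    if "x \<in> carrier ?Z" "y \<in> carrier ?Z" "x \<noteq> y" "x \<noteq> (0, 0, 0)" for x y
    using Z_mod_cube_hom_exists[OF assms(1)] that by (simp add: endomorphism_digraph_def)
  have "digraph_iso (with_proj (endomorphism_graph H)) (with_proj (endomorphism_graph ?Z))"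
  proof -
    have "card (carrier ?Z) = p ^ 3"
      using p by (simp add: carrier_Z_mod_cube card_cartesian_product power3_eq_cube)
    moreover have "finite (carrier H)"
      using assms(5) p(2) by (metis order_def card_ge_0_finite zero_less_power)
    moreover have "finite (carrier ?Z)" using p by (simp add: carrier_Z_mod_cube)
    ultimately obtain g where g: "bij_betw g (carrier H) (carrier ?Z)"
      using finite_same_card_bij[of "carrier H" "carrier ?Z"] assms(5) by (auto simp: order_def)
    show ?thesis
    proof (rule endomorphism_graphs_iso_if_complete[OF g])
      fix x y assume x: "x \<in> carrier H" and y: "y \<in> carrier H" and "x \<noteq> y"
      obtain s where s: "s \<in> carrier ?U" "x = h s"
        using x unfolding h_surj[symmetric] by (rule imageE)
      obtain t where t: "t \<in> carrier ?U" "y = h t"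
        using y unfolding h_surj[symmetric] by (rule imageE)
      have "s \<noteq> t" using s t \<open>x \<noteq> y\<close> by blast
      then have "(s, t) \<in> parcs (endomorphism_digraph ?U) \<or> (t, s) \<in> parcs (endomorphism_digraph ?U)"
        by (rule heisenberg_arc_total[OF assms(1,2) s(1) t(1)])
      then show "(x, y) \<in> parcs (endomorphism_digraph H) \<or> (y, x) \<in> parcs (endomorphism_digraph H)"
        by (simp only: h_arc[OF s(1) t(1)] h_arc[OF t(1) s(1)] s(2) t(2))
    next
      fix x y assume "x \<in> carrier ?Z" "y \<in> carrier ?Z" "x \<noteq> y"
      then show "(x, y) \<in> parcs (endomorphism_digraph ?Z) \<or> (y, x) \<in> parcs (endomorphism_digraph ?Z)"
        using Z_arc[of x y] Z_arc[of y x] by (cases "x = (0, 0, 0)") auto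
    qed
  qed
  moreover have "\<not> digraph_iso (with_proj (endomorphism_digraph H)) (with_proj (endomorphism_digraph ?Z))"
  proof
    assume "digraph_iso (with_proj (endomorphism_digraph H)) (with_proj (endomorphism_digraph ?Z))"
    then obtain g where g: "bij_betw g (carrier H) (carrier ?Z)"
      and g_arc: "\<And>x y. x \<in> carrier H \<Longrightarrow> y \<in> carrier H \<Longrightarrow>
        (x, y) \<in> parcs (endomorphism_digraph H) \<longleftrightarrow> (g x, g y) \<in> parcs (endomorphism_digraph ?Z)"
      unfolding digraph_iso_with_proj_iff[OF wf_endomorphism_digraph wf_endomorphism_digraph]
      by (auto simp: endomorphism_digraph_def)
    have gh: "bij_betw (g \<circ> h) (carrier ?U) (carrier ?Z)"
      using bij_betw_trans[OF h_bij g] .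
    have gh_in: "g (h s) \<in> carrier ?Z" if "s \<in> carrier ?U" for s
      using bij_betwE[OF gh] that by simp
    have gh_eq: "g (h s) = g (h t) \<longleftrightarrow> s = t" if "s \<in> carrier ?U" "t \<in> carrier ?U" for s t
      using inj_on_eq_iff[OF bij_betw_imp_inj_on[OF gh] that] by simp
    have h_in: "h s \<in> carrier H" if "s \<in> carrier ?U" for s
      using bij_betwE[OF h_bij] that by simp
    \<comment> \<open>Both \<open>c = 0\<close> and \<open>c = 1\<close> give a vertex without an arc to \<open>(1, 0, 0)\<close>, and zero is the only
      vertex in the range of \<open>g\<close> that lacks an arc.\<close>
    have zero: "g (h (0, 0, c)) = (0, 0, 0)" if c: "0 \<le> c" "c < int p" for c
    proof (rule ccontr)
      let ?z = "(0, 0, c)" and ?a = "(1, 0, 0) :: int \<times> int \<times> int"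
      assume nz: "g (h ?z) \<noteq> (0, 0, 0)"
      have za: "?z \<in> carrier ?U" "?a \<in> carrier ?U" using c p by (auto simp: heisenberg_def)
      have "(g (h ?z), g (h ?a)) \<in> parcs (endomorphism_digraph ?Z)"
        using Z_arc[OF gh_in[OF za(1)] gh_in[OF za(2)] _ nz] gh_eq[OF za] by simp
      then have "(?z, ?a) \<in> parcs (endomorphism_digraph ?U)"
        by (simp only: h_arc[OF za] g_arc[OF h_in[OF za(1)] h_in[OF za(2)]])
      then obtain f where "f \<in> hom ?U ?U" "f ?z = ?a" by (auto simp: endomorphism_digraph_def)
      then show False using heisenberg_hom_central[OF p(1) _ c, of f] by simp
    qed
    have "(0, 0, 0) \<in> carrier ?U" "(0, 0, 1) \<in> carrier ?U"
      using p by (auto simp: heisenberg_def)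
    then show False
      using gh_eq[of "(0, 0, 0)" "(0, 0, 1)"] zero[of 0] zero[of 1] p by simp
  qed
  ultimately show ?thesis by blast
qed

end
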